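(* Let $n\ge1$. Each of the following statistics on $S_n$ is homomesic for permutations with rotation, with the indicated average (where one is given) over every orbit of $rot$ on $S_n$: (1) the cosine of a permutation, $\sum_{i\in[n]} i\,\pi(i)$ (average $\frac{(n+1)^2n}{4}$); (2) the number of primes in the column sums of the two-line notation, i.e. the number of $i\in[n]$ with $i+\pi(i)$ prime; (3) the number of primes obtained by multiplying preimage and image and subtracting one, i.e. the number of $i\in[n]$ with $i\,\pi(i)-1$ prime; (4) the number of primes obtained by multiplying preimage and image and adding one, i.e. the number of $i\in[n]$ with $i\,\pi(i)+1$ prime; (5) $\ell\sum_{i\in[n]}\frac{1}{i+\pi(i)}$, where $\ell$ is the least common multiple of all possible values of $i+\sigma(i)$ for $\sigma\in S_n$, $i\in[n]$ (average $\frac{\ell}{n}\left((2n+1)H_{2n}-(2n+2)H_n\right)$); (6) half the number of preimage-image pairs of different parity, i.e. $\frac12\#\{i\in[n]: i+\pi(i)\text{ is odd}\}$ (average $\frac1n\lfloor\frac n2\rfloor\lceil\frac n2\rceil$).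
   Context: $[n]=\{1,\dots,n\}$ and $S_n$ is the set of permutations of $[n]$, written in one-line notation $\pi=\pi(1)\pi(2)\cdots\pi(n)$. The rotation map $rot:S_n\to S_n$ sends $\pi(1)\pi(2)\cdots\pi(n)$ to $\pi(2)\cdots\pi(n)\pi(1)$. For a bijection $\varphi:S_n\to S_n$, the orbits are the sets $\{\varphi^m(\pi)\}$ of permutations obtained by applying $\varphi$ any number of times. A statistic $st$ is homomesic for $\varphi$ if there is a constant $c$ (the average) such that $\frac{1}{\#\mathcal{O}}\sum_{x\in\mathcal{O}}st(x)=c$ for every orbit $\mathcal{O}$. $H_m=\sum_{i=1}^m\frac1i$ is the $m$-th harmonic number. *)

theory Defs
  imports
    "HOL-Combinatorics.Permutations"
    "HOL-Combinatorics.Orbits"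
    "HOL-Computational_Algebra.Primes"
    "HOL-Analysis.Harmonic_Numbers"
begin

definition perms :: "nat \<Rightarrow> (nat \<Rightarrow> nat) set" where
  "perms n = {p. p permutes {1..n}}"

text \<open>In one-line notation, \<open>p 1, \<dots>, p n\<close> becomes \<open>p 2, \<dots>, p n, p 1\<close>.  As
  \<open>permutes\<close> requires, the result is the identity outside \<open>{1..n}\<close>.\<close>

definition rot :: "nat \<Rightarrow> (nat \<Rightarrow> nat) \<Rightarrow> (nat \<Rightarrow> nat)" where
  "rot n p = (\<lambda>i. if i \<in> {1..<n} then p (i + 1) else if i = n then p 1 else i)"

definition iter_orbit :: "('a \<Rightarrow> 'a) \<Rightarrow> 'a \<Rightarrow> 'a set" where
  "iter_orbit \<phi> x = {(\<phi> ^^ m) x | m. True}"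

definition orbits_on :: "'a set \<Rightarrow> ('a \<Rightarrow> 'a) \<Rightarrow> 'a set set" where
  "orbits_on S \<phi> = iter_orbit \<phi> ` S"

text \<open>Meant for a bijection \<open>\<phi>\<close> of a finite set \<open>S\<close>, where orbits are finite and
  \<open>iter_orbit\<close> agrees with \<open>orbit\<close> (lemma \<open>iter_orbit_eq_orbit\<close> below).\<close>

definition homomesic_with :: "'a set \<Rightarrow> ('a \<Rightarrow> 'a) \<Rightarrow> ('a \<Rightarrow> real) \<Rightarrow> real \<Rightarrow> bool" where
  "homomesic_with S \<phi> st c \<longleftrightarrow>
     (\<forall>Orb \<in> orbits_on S \<phi>. 1 / real (card Orb) * (\<Sum>x\<in>Orb. st x) = c)"

definition homomesic :: "'a set \<Rightarrow> ('a \<Rightarrow> 'a) \<Rightarrow> ('a \<Rightarrow> real) \<Rightarrow> bool" where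
  "homomesic S \<phi> st \<longleftrightarrow> (\<exists>c. homomesic_with S \<phi> st c)"

definition lcm_sums :: "nat \<Rightarrow> nat" where
  "lcm_sums n = Lcm {i + \<sigma> i | i \<sigma>. \<sigma> \<in> perms n \<and> i \<in> {1..n}}"

lemma iter_orbit_eq_orbit:
  assumes "finite S" and "bij_betw \<phi> S S" and "x \<in> S"
  shows "iter_orbit \<phi> x = orbit \<phi> x"
proof -
  have iter: "bij_betw (\<phi> ^^ m) S S" for m
    by (rule bij_betw_funpow[OF assms(2)])
  then have "range (\<lambda>m. (\<phi> ^^ m) x) \<subseteq> S"
    using assms(3) by (auto dest: bij_betwE)
  then have "finite (range (\<lambda>m. (\<phi> ^^ m) x))"
    using assms(1) finite_subset by blast
  then have "\<not> inj (\<lambda>m. (\<phi> ^^ m) x)"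
    using finite_imageD infinite_UNIV_nat by blast
  then obtain a b where "a < b" and ab: "(\<phi> ^^ a) x = (\<phi> ^^ b) x"
    by (metis (mono_tags, lifting) injI linorder_neqE_nat)
  then have "(\<phi> ^^ a) x = (\<phi> ^^ a) ((\<phi> ^^ (b - a)) x)"
    by (metis funpow_add le_add_diff_inverse less_imp_le o_apply)
  then have "(\<phi> ^^ (b - a)) x = x"
    using bij_betw_imp_inj_on[OF iter[of a]] bij_betwE[OF iter[of "b - a"]] assms(3)
    by (metis inj_onD)
  then have "x \<in> orbit \<phi> x"
    using \<open>a < b\<close> unfolding orbit_altdef by (metis (mono_tags, lifting) mem_Collect_eq zero_less_diff)
  then show ?thesis
    unfolding iter_orbit_def orbit_altdef
    by (smt (verit) Collect_cong funpow_0 mem_Collect_eq neq0_conv)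
qed

lemma rot_eq_comp:
  assumes "n \<ge> 1" and "p \<in> perms n"
  shows "rot n p = p \<circ> rot n id"
proof
  fix i
  have "p i = i" if "i \<notin> {1..n}"
    using assms(2) that unfolding perms_def by (metis mem_Collect_eq permutes_not_in)
  then show "rot n p i = (p \<circ> rot n id) i"
    using assms(1) by (cases "i \<in> {1..n}") (auto simp: rot_def)
qed

lemma rot_id_permutes:
  assumes "n \<ge> 1"
  shows "rot n id permutes {1..n}"
proof (rule bij_imp_permutes)
  have "inj_on (rot n id) {1..n}"
    by (auto simp: inj_on_def rot_def split: if_splits)
  moreover have "rot n id ` {1..n} \<subseteq> {1..n}"
    by (auto simp: rot_def)
  ultimately show "bij_betw (rot n id) {1..n} {1..n}"
    by (simp add: bij_betw_def endo_inj_surj)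
next
  fix x assume "x \<notin> {1..n}"
  then show "rot n id x = x"
    using assms by (auto simp: rot_def)
qed

lemma bij_betw_rot:
  assumes "n \<ge> 1"
  shows "bij_betw (rot n) (perms n) (perms n)"
proof -
  have fin: "finite (perms n)"
    by (simp add: perms_def finite_permutations)
  have "rot n p \<in> perms n" if "p \<in> perms n" for p
    unfolding rot_eq_comp[OF assms that]
    using that permutes_compose[OF rot_id_permutes[OF assms]] by (simp add: perms_def)
  then have into: "rot n ` perms n \<subseteq> perms n"
    by blast
  have "inj_on (rot n) (perms n)"
  proof (rule inj_onI)
    fix p q assume p: "p \<in> perms n" and q: "q \<in> perms n" and eq: "rot n p = rot n q"
    have comp: "p \<circ> rot n id = q \<circ> rot n id"
      using eq unfolding rot_eq_comp[OF assms p] rot_eq_comp[OF assms q] .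
    show "p = q"
    proof
      fix j
      obtain i where "j = rot n id i"
        using permutes_surj[OF rot_id_permutes[OF assms]] by (metis surjD)
      then show "p j = q j"
        using fun_cong[OF comp, of i] by simp
    qed
  qed
  with fin into show ?thesis
    by (simp add: bij_betw_def endo_inj_surj)
qed

end

theory Submission
  imports Defs "HOL-Number_Theory.Cong"
begin

text \<open>
  Every statistic in the theorem is a multiple of a sum \<open>\<Sum>i. f i (p i)\<close> over the points
  \<open>(i, p i)\<close> of the permutation matrix, and all such sums are homomesic for rotation, for one
  reason.  Rotation composes \<open>p\<close> on the right with the \<open>n\<close>-cycle \<open>i \<mapsto> i + 1\<close>.  So the orbit of
  \<open>p\<close> has exactly \<open>n\<close> elements, and as \<open>x\<close> runs through it, \<open>x i\<close> takes, for each fixed position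
  \<open>i\<close>, every value in \<open>{1..n}\<close> exactly once: superimposed, the \<open>n\<close> permutation matrices give the
  all-ones matrix.  The sum of the statistic over the orbit is therefore
  \<open>\<Sum>i. \<Sum>j. f i j\<close>, which does not depend on the orbit (lemma \<open>homomesic_with_sum_entries\<close>).

  The three averages are then double sums over the square \<open>{1..n} \<times> {1..n}\<close>: the squared sum of
  the first \<open>n\<close> integers for the cosine, a harmonic sum for the reciprocals of \<open>i + j\<close>, and
  for the parities the number of pairs consisting of an odd and an even integer, in either order.
\<close>

section \<open>The orbits of rotation\<close>

lemma rot_id_funpow:
  assumes "i \<in> {1..n}"
  shows "(rot n id ^^ m) i = (i - 1 + m) mod n + 1"
proof (induction m)
  case 0
  then show ?case using assms by (cases i) auto
next
  case (Suc m)
  define k where "k = (i - 1 + m) mod n"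
  have "k < n"
    using assms by (simp add: k_def)
  then have "rot n id (k + 1) = Suc k mod n + 1"
    by (auto simp: rot_def mod_Suc)
  also have "Suc k mod n = (i - 1 + Suc m) mod n"
    by (simp add: k_def mod_Suc_eq)
  finally show ?case
    using Suc by (simp add: k_def)
qed

lemma rot_funpow_eq_comp:
  assumes "n \<ge> 1" and "p \<in> perms n"
  shows "(rot n ^^ m) p = p \<circ> (rot n id ^^ m)"
proof (induction m)
  case (Suc m)
  have "(rot n ^^ m) p \<in> perms n"
    using bij_betwE[OF bij_betw_funpow[OF bij_betw_rot[OF assms(1)]]] assms(2) by blast
  then have "rot n ((rot n ^^ m) p) = (rot n ^^ m) p \<circ> rot n id"
    by (rule rot_eq_comp[OF assms(1)])
  then have "(rot n ^^ Suc m) p = p \<circ> (rot n id ^^ m) \<circ> rot n id"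
    by (simp only: Suc funpow.simps(2) o_apply[of "rot n"])
  then show ?case
    by (simp only: comp_assoc funpow_Suc_right)
qed simp

lemma bij_betw_rotations:
  assumes "i \<in> {1..n}"
  shows "bij_betw (\<lambda>m. (rot n id ^^ m) i) {..<n} {1..n}"
proof -
  have "inj_on (\<lambda>m. (i - 1 + m) mod n + 1) {..<n}"
    by (auto simp: inj_on_def intro!: cong_less_modulus_unique_nat
        simp flip: cong_def simp: cong_add_lcancel_nat)
  moreover have "(\<lambda>m. (i - 1 + m) mod n + 1) ` {..<n} \<subseteq> {1..n}"
    by (auto simp: Suc_le_eq)
  moreover have "card {..<n} = card {1..n}" by simp
  ultimately have "bij_betw (\<lambda>m. (i - 1 + m) mod n + 1) {..<n} {1..n}"
    unfolding bij_betw_def by (metis card_image card_subset_eq finite_atLeastAtMost)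
  then show ?thesis
    by (simp add: rot_id_funpow[OF assms])
qed

text \<open>The \<open>n\<close>-fold rotation is the identity, so exponents below \<open>n\<close> suffice; they give different
  permutations because already the values at the position \<open>1\<close> differ.\<close>

lemma bij_betw_iter_orbit_rot:
  assumes "n \<ge> 1" and "p \<in> perms n"
  shows "bij_betw (\<lambda>m. (rot n ^^ m) p) {..<n} (iter_orbit (rot n) p)"
proof (rule bij_betw_imageI)
  have inj_p: "inj p"
    using assms(2) by (auto simp: perms_def permutes_inj)
  show "inj_on (\<lambda>m. (rot n ^^ m) p) {..<n}"
  proof (rule inj_onI)
    fix k m assume km: "k \<in> {..<n}" "m \<in> {..<n}" and "(rot n ^^ k) p = (rot n ^^ m) p"
    then have "p ((rot n id ^^ k) 1) = p ((rot n id ^^ m) 1)"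
      by (metis rot_funpow_eq_comp[OF assms] comp_apply)
    then show "k = m"
      using km assms(1) injD[OF inj_p] rot_id_funpow[of 1 n] by fastforce
  qed
  have "(rot n ^^ n) p = p"
  proof
    fix i
    have "(rot n id ^^ n) i = i"
    proof (cases "i \<in> {1..n}")
      case True
      then show ?thesis using rot_id_funpow[OF True, of n] by (cases i) auto
    next
      case False
      then have "rot n id i = i"
        using permutes_not_in[OF rot_id_permutes[OF assms(1)]] by blast
      then have "(rot n id ^^ m) i = i" for m by (induction m) simp_all
      then show ?thesis .
    qed
    then show "(rot n ^^ n) p i = p i"
      by (simp add: rot_funpow_eq_comp[OF assms])
  qed
  then have "(rot n ^^ m) p = (rot n ^^ (m mod n)) p" for m
    by (simp add: funpow_mod_eq)
  moreover have "m mod n < n" for m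
    using assms(1) by simp
  ultimately show "(\<lambda>m. (rot n ^^ m) p) ` {..<n} = iter_orbit (rot n) p"
    unfolding iter_orbit_def by blast
qed

section \<open>Homomesy of sums over the entries of the permutation matrix\<close>

text \<open>After exchanging the two sums, position \<open>i\<close> contributes \<open>f i\<close> summed over the values at \<open>i\<close>
  along the orbit.  These are \<open>p\<close> of all cyclic shifts of \<open>i\<close>, hence each element of \<open>{1..n}\<close>
  once.\<close>

lemma homomesic_with_sum_entries:
  fixes f :: "nat \<Rightarrow> nat \<Rightarrow> real"
  assumes "n \<ge> 1"
  shows "homomesic_with (perms n) (rot n) (\<lambda>p. \<Sum>i\<in>{1..n}. f i (p i))
           (1 / real n * (\<Sum>i\<in>{1..n}. \<Sum>j\<in>{1..n}. f i j))"
  unfolding homomesic_with_def orbits_on_def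
proof safe
  fix p assume p: "p \<in> perms n"
  let ?O = "iter_orbit (rot n) p"
  note bij = bij_betw_iter_orbit_rot[OF assms p]
  have "(\<Sum>x\<in>?O. \<Sum>i\<in>{1..n}. f i (x i)) = (\<Sum>m<n. \<Sum>i\<in>{1..n}. f i ((rot n ^^ m) p i))"
    by (rule sum.reindex_bij_betw[OF bij, symmetric])
  also have "\<dots> = (\<Sum>i\<in>{1..n}. \<Sum>m<n. f i (p ((rot n id ^^ m) i)))"
    by (subst sum.swap) (simp add: rot_funpow_eq_comp[OF assms p])
  also have "\<dots> = (\<Sum>i\<in>{1..n}. \<Sum>j\<in>{1..n}. f i (p j))"
    by (intro sum.cong refl sum.reindex_bij_betw bij_betw_rotations)
  also have "\<dots> = (\<Sum>i\<in>{1..n}. \<Sum>j\<in>{1..n}. f i j)"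
    using p by (intro sum.cong refl sum.reindex_bij_betw permutes_imp_bij) (simp add: perms_def)
  finally have "(\<Sum>x\<in>?O. \<Sum>i\<in>{1..n}. f i (x i)) = (\<Sum>i\<in>{1..n}. \<Sum>j\<in>{1..n}. f i j)" .
  moreover have "card ?O = n"
    using bij_betw_same_card[OF bij] by simp
  ultimately show "1 / real (card ?O) * (\<Sum>x\<in>?O. \<Sum>i\<in>{1..n}. f i (x i))
      = 1 / real n * (\<Sum>i\<in>{1..n}. \<Sum>j\<in>{1..n}. f i j)"
    by simp
qed

lemma homomesic_with_cmult:
  assumes "homomesic_with S \<phi> st c"
  shows "homomesic_with S \<phi> (\<lambda>x. a * st x) (a * c)"
  using assms unfolding homomesic_with_def
  by (simp add: sum_distrib_left[symmetric] mult.left_commute)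

lemma card_filter_eq_sum_of_bool:
  "finite A \<Longrightarrow> real (card {i \<in> A. P i}) = (\<Sum>i\<in>A. of_bool (P i))"
  by (simp add: sum_of_bool_eq Int_def)

lemma homomesic_with_card_entries:
  assumes "n \<ge> 1"
  shows "homomesic_with (perms n) (rot n) (\<lambda>p. real (card {i \<in> {1..n}. P i (p i)}))
           (1 / real n * (\<Sum>i\<in>{1..n}. \<Sum>j\<in>{1..n}. of_bool (P i j)))"
  using homomesic_with_sum_entries[OF assms, of "\<lambda>i j. of_bool (P i j)"]
  by (simp only: card_filter_eq_sum_of_bool finite_atLeastAtMost)

section \<open>The double sums giving the averages\<close>

lemma sum_square_mult:
  "(\<Sum>i\<in>{1..n}. \<Sum>j\<in>{1..n}. real i * real j) = (real n * (real n + 1) / 2)\<^sup>2"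
proof -
  have "(\<Sum>i\<in>{1..n}. real i) = real n * (real n + 1) / 2"
    by (induction n) (simp_all add: field_simps)
  then show ?thesis
    by (simp only: sum_product[symmetric] power2_eq_square)
qed

text \<open>Passing from \<open>n\<close> to \<open>n + 1\<close> adds to the square a row and a column, which are equal by
  symmetry, and a corner; the row is a block of consecutive reciprocals and so a difference of
  harmonic numbers.\<close>

lemma sum_square_inverse_add:
  "(\<Sum>i\<in>{1..n}. \<Sum>j\<in>{1..n}. 1 / real (i + j))
     = (2 * real n + 1) * harm (2 * n) - (2 * real n + 2) * harm n"
proof (induction n)
  case 0
  show ?case by (simp add: harm_def)
next
  case (Suc n)
  have row: "(\<Sum>i\<in>{1..k}. 1 / real (i + m)) = harm (k + m) - harm m" for k m
    by (induction k) (simp_all add: harm_Suc inverse_eq_divide)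
  have "(\<Sum>i\<in>{1..Suc n}. \<Sum>j\<in>{1..Suc n}. 1 / real (i + j))
      = (\<Sum>i\<in>{1..n}. \<Sum>j\<in>{1..n}. 1 / real (i + j))
        + (\<Sum>i\<in>{1..n}. 1 / real (i + Suc n)) + (\<Sum>j\<in>{1..n}. 1 / real (Suc n + j))
        + 1 / real (Suc n + Suc n)"
    by (simp add: sum.distrib add_ac)
  also have "(\<Sum>j\<in>{1..n}. 1 / real (Suc n + j)) = (\<Sum>i\<in>{1..n}. 1 / real (i + Suc n))"
    by (simp only: add.commute)
  also have "(\<Sum>i\<in>{1..n}. 1 / real (i + Suc n)) = harm (n + Suc n) - harm (Suc n)"
    by (rule row)
  finally have eq: "(\<Sum>i\<in>{1..Suc n}. \<Sum>j\<in>{1..Suc n}. 1 / real (i + j))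
      = (2 * real n + 1) * harm (2 * n) - (2 * real n + 2) * harm n
        + 2 * (harm (n + Suc n) - harm (Suc n)) + 1 / (2 * (real n + 1))"
    by (simp only: Suc) (simp add: field_simps)
  have h: "harm (n + Suc n) = harm (2 * n) + 1 / (2 * real n + 1)"
    "harm (2 * Suc n) = harm (2 * n) + 1 / (2 * real n + 1) + 1 / (2 * (real n + 1))"
    "harm (Suc n) = harm n + 1 / (real n + 1)"
    by (simp_all add: harm_Suc inverse_eq_divide mult_2[symmetric] algebra_simps)
  have "2 * real n + 1 \<noteq> 0" "real n + 1 \<noteq> 0" by linarith+
  then show ?case
    unfolding eq h by (simp add: divide_simps) (simp add: algebra_simps)
qed

lemma sum_square_odd_add:
  "(\<Sum>i\<in>{1..n}. \<Sum>j\<in>{1..n}. of_bool (odd (i + j)))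
     = 2 * real_of_int \<lfloor>real n / 2\<rfloor> * real_of_int \<lceil>real n / 2\<rceil>"
proof -
  have even: "(\<Sum>i\<in>{1..n}. of_bool (even i)) = real (n div 2)"
    by (induction n) auto
  have odd: "(\<Sum>i\<in>{1..n}. of_bool (odd i)) = real (Suc n div 2)"
    by (induction n) auto
  have split: "of_bool (odd (i + j)) =
      (of_bool (odd i) * of_bool (even j) + of_bool (even i) * of_bool (odd j) :: real)"
    for i j :: nat
    by simp
  have "real_of_int \<lfloor>real n / 2\<rfloor> = real (n div 2)"
    using floor_divide_of_nat_eq[of n 2, where ?'a = real] by simp
  moreover have "real_of_int \<lceil>real n / 2\<rceil> = real (Suc n div 2)"
  proof -
    have "\<lceil>real n / 2\<rceil> = int (Suc n div 2)"
      by (rule ceiling_unique) linarith+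
    then show ?thesis by simp
  qed
  ultimately show ?thesis
    unfolding split sum.distrib sum_product[symmetric] even odd by simp
qed

section \<open>The six statistics\<close>

theorem theorem2p11:
  fixes n :: nat
  assumes "n \<ge> 1"
  shows
    "homomesic_with (perms n) (rot n)
       (\<lambda>p. \<Sum>i\<in>{1..n}. real i * real (p i))
       ((real n + 1)\<^sup>2 * real n / 4) \<and>
     homomesic (perms n) (rot n)
       (\<lambda>p. real (card {i \<in> {1..n}. prime (i + p i)})) \<and>
     homomesic (perms n) (rot n)
       (\<lambda>p. real (card {i \<in> {1..n}. prime (i * p i - 1)})) \<and>
     homomesic (perms n) (rot n)
       (\<lambda>p. real (card {i \<in> {1..n}. prime (i * p i + 1)})) \<and>
     homomesic_with (perms n) (rot n)
       (\<lambda>p. real (lcm_sums n) * (\<Sum>i\<in>{1..n}. 1 / real (i + p i)))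
       (real (lcm_sums n) / real n *
         ((2 * real n + 1) * harm (2 * n) - (2 * real n + 2) * harm n)) \<and>
     homomesic_with (perms n) (rot n)
       (\<lambda>p. 1 / 2 * real (card {i \<in> {1..n}. odd (i + p i)}))
       (1 / real n * real_of_int \<lfloor>real n / 2\<rfloor> * real_of_int \<lceil>real n / 2\<rceil>)"
proof (intro conjI)
  show "homomesic_with (perms n) (rot n) (\<lambda>p. \<Sum>i\<in>{1..n}. real i * real (p i))
      ((real n + 1)\<^sup>2 * real n / 4)"
    using homomesic_with_sum_entries[OF assms, of "\<lambda>i j. real i * real j"] assms
    unfolding sum_square_mult by (simp add: power2_eq_square mult_ac)
  show "homomesic (perms n) (rot n) (\<lambda>p. real (card {i \<in> {1..n}. prime (i + p i)}))"
    "homomesic (perms n) (rot n) (\<lambda>p. real (card {i \<in> {1..n}. prime (i * p i - 1)}))"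
    "homomesic (perms n) (rot n) (\<lambda>p. real (card {i \<in> {1..n}. prime (i * p i + 1)}))"
    unfolding homomesic_def by (rule exI, rule homomesic_with_card_entries[OF assms])+
  show "homomesic_with (perms n) (rot n)
      (\<lambda>p. real (lcm_sums n) * (\<Sum>i\<in>{1..n}. 1 / real (i + p i)))
      (real (lcm_sums n) / real n *
        ((2 * real n + 1) * harm (2 * n) - (2 * real n + 2) * harm n))"
    using homomesic_with_cmult[OF homomesic_with_sum_entries[OF assms],
        of "real (lcm_sums n)" "\<lambda>i j. 1 / real (i + j)"]
    unfolding sum_square_inverse_add by simp
  show "homomesic_with (perms n) (rot n)
      (\<lambda>p. 1 / 2 * real (card {i \<in> {1..n}. odd (i + p i)}))
      (1 / real n * real_of_int \<lfloor>real n / 2\<rfloor> * real_of_int \<lceil>real n / 2\<rceil>)"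
    using homomesic_with_cmult[OF homomesic_with_card_entries[OF assms],
        of "1 / 2" "\<lambda>i j. odd (i + j)"]
    unfolding sum_square_odd_add by simp
qed

end
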